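(* For every integer $n\ge 2$, the numbers $a^C(K_n)$ of assembly trees satisfying the connected gluing rule for the complete graphs $K_n$ satisfy $$a^C(K_n)=\sum_{k=2}^n\left[\sum_{\lambda\in Part(n,k)}\frac{\binom{n}{\lambda_1,\dots,\lambda_k}}{\prod_{i=1}^n m_i(\lambda)!}\prod_{j=1}^k a^C(K_{\lambda_j})\right],$$ where $Part(n,k)$ is the set of integer partitions $\lambda=(\lambda_1,\dots,\lambda_k)$ of $n$ into $k$ parts and $m_i(\lambda)$ is the number of occurrences of $i$ in the partition $\lambda$.
   Context: All graphs are finite and simple. Let $G=(V,E)$ be a connected graph with $|V|=N$. An assembly tree for $G$ is a rooted (unordered) tree each of whose nodes is labeled by a subset $U\subseteq V$ such that: (1) the label of the root is $V$; (2) each internal node $U$ has at least two children, and $U$ is the union of the labels of its children; (3) there are exactly $N$ leaves, labeled by the $N$ vertices of $G$ respectively (a vertex $v$ being identified with $\{v\}$). Two assembly trees are the same if there is a label-preserving isomorphism of rooted trees between them. An assembly tree satisfies the connected gluing rule if for each internal node, the subgraph of $G$ induced by the vertices in its label is connected. $a^C(G)$ denotes the number of assembly trees for $G$ satisfying the connected gluing rule. $K_n$ is the complete graph on $n$ vertices. $\lambda\in Part(n,k)$ means $\lambda=(\lambda_1,\dots,\lambda_k)$ with $\lambda_1\ge\lambda_2\ge\cdots\ge\lambda_k>0$ integers and $\lambda_1+\cdots+\lambda_k=n$; $\binom{n}{\lambda_1,\dots,\lambda_k}$ is the multinomial coefficient. *)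

theory Defs
  imports Complex_Main "HOL-Library.Multiset" "Graph_Theory.Graph_Theory" "Graph_Theory.Kuratowski"
begin

text \<open>
  Simple graphs are the locale \<open>graph\<close> of \<open>Graph_Theory\<close>: finite, loop-free symmetric digraphs
  without parallel arcs, an edge \<open>uv\<close> being the two arcs \<open>(u, v)\<close> and \<open>(v, u)\<close>.
\<close>

text \<open>
  Rooted trees with set-labelled nodes. The children form a multiset, so siblings are unordered
  and may coincide; hence two values are equal iff there is a label-preserving isomorphism of
  rooted trees between them, and counting values counts trees up to isomorphism.
\<close>

datatype 'a ltree = Node (label: "'a set") (children: "'a ltree multiset")

text \<open>Every node of a tree, represented by the subtree rooted at it.\<close>

primrec subtrees :: "'a ltree \<Rightarrow> 'a ltree set" where
  "subtrees (Node U ts) = insert (Node U ts) (\<Union> (set_mset (image_mset subtrees ts)))"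

definition internal :: "'a ltree \<Rightarrow> bool" where
  "internal t \<longleftrightarrow> children t \<noteq> {#}"

text \<open>The labels of the leaves, each as often as it occurs on a leaf.\<close>

primrec leaf_labels :: "'a ltree \<Rightarrow> 'a set multiset" where
  "leaf_labels (Node U ts) =
     (if ts = {#} then {#U#} else \<Sum>\<^sub># (image_mset leaf_labels ts))"

definition assembly_tree :: "('a, 'b) pre_digraph \<Rightarrow> 'a ltree \<Rightarrow> bool" where
  "assembly_tree G t \<longleftrightarrow>
     (\<forall>s \<in> subtrees t. label s \<subseteq> verts G) \<and>
     label t = verts G \<and>
     (\<forall>s \<in> subtrees t. internal s \<longrightarrow>
        2 \<le> size (children s) \<and> label s = (\<Union>c \<in> set_mset (children s). label c)) \<and>
     leaf_labels t = image_mset (\<lambda>v. {v}) (mset_set (verts G))"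

definition connected_gluing :: "('a, 'b) pre_digraph \<Rightarrow> 'a ltree \<Rightarrow> bool" where
  "connected_gluing G t \<longleftrightarrow>
     (\<forall>s \<in> subtrees t. internal s \<longrightarrow> Digraph_Component.connected (G \<restriction> label s))"

definition num_assembly_trees_C :: "('a, 'b) pre_digraph \<Rightarrow> nat" (\<open>a\<^sup>C\<close>) where
  "a\<^sup>C G = card {t. assembly_tree G t \<and> connected_gluing G t}"

definition complete_graph :: "nat \<Rightarrow> (nat, nat \<times> nat) pre_digraph" where
  "complete_graph n =
     with_proj \<lparr> pverts = {..<n}, parcs = {(u, v). u < n \<and> v < n \<and> u \<noteq> v} \<rparr>"

lemma complete_digraph_complete_graph: "complete_digraph n (complete_graph n)"
  unfolding complete_graph_def complete_digraph_pair_def by auto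

lemma graph_complete_graph: "graph (complete_graph n)"
  using complete_digraph_complete_graph unfolding complete_digraph_def by blast

lemma connected_complete_graph:
  assumes "0 < n"
  shows "Digraph_Component.connected (complete_graph n)"
proof -
  interpret graph "complete_graph n" by (rule graph_complete_graph)
  have V: "verts (complete_graph n) = {..<n}"
    and E: "arcs_ends (complete_graph n) = {(u, v). u < n \<and> v < n \<and> u \<noteq> v}"
    by (simp_all add: complete_graph_def)
  have "u \<rightarrow>\<^sup>*\<^bsub>complete_graph n\<^esub> v" if "u < n" "v < n" for u v
  proof (cases "u = v")
    case True
    then show ?thesis using that V by simp
  next
    case False
    then have "u \<rightarrow>\<^bsub>complete_graph n\<^esub> v" using that E by simp
    then show ?thesis by (rule reachable_adjI)
  qed
  then have "u \<rightarrow>\<^sup>*\<^bsub>with_proj (mk_symmetric (complete_graph n))\<^esub> v" if "u < n" "v < n" for u v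
    using that reachable_mk_symmetricI by blast
  then show ?thesis
    using assms V unfolding Digraph_Component.connected_def strongly_connected_def by auto
qed

definition Part :: "nat \<Rightarrow> nat \<Rightarrow> nat list set" where
  "Part n k = {l. length l = k \<and> sorted_wrt (\<ge>) l \<and> (\<forall>x \<in> set l. 0 < x) \<and> sum_list l = n}"

definition multinomial :: "nat \<Rightarrow> nat list \<Rightarrow> real" where
  "multinomial n l = fact n / (\<Prod>j<length l. fact (l ! j))"

end

theory Submission
  imports Defs "HOL-Library.Disjoint_Sets"
begin

text \<open>
  Connectivity is no restriction in a complete graph, so \<open>a\<^sup>C (complete_graph n)\<close> counts all
  assembly trees on an \<open>n\<close>-element set. Cutting such a tree at its root gives a partition of the
  vertex set into at least two blocks, the labels of the children, together with an assembly tree on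
  each block; conversely any such partition with a tree on each block can be joined under a new root
  (\<open>bij_betw_join_trees\<close>). Hence the number of trees is a sum over set partitions of products
  over the blocks (\<open>card_trees_on_rec\<close>).

  Each factor depends only on the size of its block, so the set partitions are collected by type, that
  is, by the integer partition formed by the block sizes. The number of set partitions of
  a given type is the multinomial coefficient, which counts partitions into a sequence of blocks of
  prescribed sizes, divided by the factorials of the multiplicities, which count the reorderings of
  blocks of equal size (\<open>card_partitions_of_type\<close>, \<open>sum_partitions_by_type\<close>).

  That the number of trees depends only on the size of the vertex set follows by strong induction
  from the recursion itself: once this holds for the blocks, the recursion expresses the number for
  the whole set through sizes alone (\<open>card_trees_on_eq\<close>).
\<close>

section \<open>Counting set partitions by block sizes\<close>

lemma card_Cons_UN:
  assumes "finite S" "\<And>p. p \<in> S \<Longrightarrow> finite (X p)"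
  shows "card (\<Union>p\<in>S. (#) p ` X p) = (\<Sum>p\<in>S. card (X p))"
proof -
  have "card (\<Union>p\<in>S. (#) p ` X p) = (\<Sum>p\<in>S. card ((#) p ` X p))"
    using assms by (intro card_UN_disjoint) auto
  also have "\<dots> = (\<Sum>p\<in>S. card (X p))"
    by (intro sum.cong refl card_image) auto
  finally show ?thesis .
qed

text \<open>
  An ordering of \<open>P\<close> that realises the word \<open>l\<close> is found by deciding, for each value \<open>i\<close>
  separately, in which order the elements with \<open>f\<close>-value \<open>i\<close> fill the positions of \<open>l\<close> that carry
  \<open>i\<close>. These orders account for the factorials of the multiplicities. The index set \<open>I\<close> may be
  larger than \<open>set l\<close>, so that it stays fixed while \<open>l\<close> shrinks in the induction.
\<close>

lemma card_orderings_with_image: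
  assumes "finite P" "image_mset f (mset_set P) = mset l" "finite I" "set l \<subseteq> I"
  shows "card {xs. distinct xs \<and> set xs = P \<and> map f xs = l} = (\<Prod>i\<in>I. fact (count_list l i))"
  using assms
proof (induction l arbitrary: P)
  case Nil
  then have "P = {}" by (simp add: mset_set_empty_iff)
  then show ?case by (simp add: conj_commute cong: conj_cong)
next
  case (Cons x l)
  let ?X = "\<lambda>P l. {xs. distinct xs \<and> set xs = P \<and> map f xs = l}"
  let ?S = "{p \<in> P. f p = x}"
  have dec: "?X P (x # l) = (\<Union>p\<in>?S. (#) p ` ?X (P - {p}) l)"
  proof (intro equalityI subsetI)
    fix xs assume "xs \<in> ?X P (x # l)"
    then show "xs \<in> (\<Union>p\<in>?S. (#) p ` ?X (P - {p}) l)" by (cases xs) auto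
  next
    fix xs assume "xs \<in> (\<Union>p\<in>?S. (#) p ` ?X (P - {p}) l)"
    then obtain p ys where p: "p \<in> P" "f p = x" and xs: "xs = p # ys"
      and ys: "distinct ys" "set ys = P - {p}" "map f ys = l"
      by blast
    have "set xs = P" using p(1) unfolding xs list.set ys(2) by blast
    then show "xs \<in> ?X P (x # l)" using p(2) xs ys by simp
  qed
  have fin: "finite (?X Q l)" if "finite Q" for Q
    by (rule finite_subset[OF _ finite_lists_length_eq[OF that, of "length l"]]) auto
  have IH: "card (?X (P - {p}) l) = (\<Prod>i\<in>I. fact (count_list l i))" if "p \<in> ?S" for p
  proof (rule Cons.IH)
    have "mset_set P = add_mset p (mset_set (P - {p}))"
      using that Cons.prems(1) by (simp add: mset_set.remove)
    then show "image_mset f (mset_set (P - {p})) = mset l"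
      using that Cons.prems(2) by simp
  qed (use Cons.prems in auto)
  have "card ?S = size (filter_mset (\<lambda>p. f p = x) (mset_set P))"
    using Cons.prems(1) by (metis filter_mset_mset_set size_mset_set)
  also have "\<dots> = count (image_mset f (mset_set P)) x"
    by (simp add: count_conv_size_mset filter_mset_image_mset)
  also have "\<dots> = Suc (count_list l x)"
    by (simp add: Cons.prems(2) count_mset)
  finally have cS: "card ?S = Suc (count_list l x)" .
  have "card (?X P (x # l)) = (\<Sum>p\<in>?S. card (?X (P - {p}) l))"
    unfolding dec using Cons.prems(1) by (intro card_Cons_UN fin) auto
  also have "\<dots> = Suc (count_list l x) * (\<Prod>i\<in>I. fact (count_list l i))"
    using IH cS by simp
  also have "\<dots> = (\<Prod>i\<in>I. fact (count_list (x # l) i))"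
  proof -
    have "(\<Prod>i\<in>I - {x}. fact (count_list (x # l) i) :: nat) = (\<Prod>i\<in>I - {x}. fact (count_list l i))"
      by (intro prod.cong) auto
    moreover have "x \<in> I" using Cons.prems(4) by simp
    moreover have "(fact (count_list (x # l) x) :: nat) = Suc (count_list l x) * fact (count_list l x)"
      by simp
    ultimately show ?thesis
      unfolding prod.remove[OF Cons.prems(3) \<open>x \<in> I\<close>] by (simp only: mult.assoc)
  qed
  finally show ?case .
qed

definition ordered_partitions :: "'a set \<Rightarrow> nat list \<Rightarrow> 'a set list set" where
  "ordered_partitions A l = {Bs. distinct Bs \<and> partition_on A (set Bs) \<and> map card Bs = l}"

lemma finite_ordered_partitions:
  assumes "finite A"
  shows "finite (ordered_partitions A l)"
  by (rule finite_subset[OF _ finite_lists_length_eq[of "Pow A" "length l"]])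
     (use assms in \<open>auto simp: ordered_partitions_def partition_on_def\<close>)

text \<open>
  Removing the first block leaves an ordered partition of its complement; conversely, any subset of
  the prescribed size can be the first block, being nonempty since the sizes are positive. The
  binomial coefficients of the successive choices multiply to a multinomial coefficient.
\<close>

lemma card_ordered_partitions:
  assumes "finite A" "\<forall>x\<in>set l. 0 < x" "sum_list l = card A"
  shows "card (ordered_partitions A l) * prod_list (map fact l) = fact (card A)"
  using assms
proof (induction l arbitrary: A)
  case Nil
  then have "ordered_partitions A [] = {[]}"
    by (auto simp: ordered_partitions_def partition_on_empty)
  then show ?case using Nil by simp
next
  case (Cons x l)
  let ?S = "{B. B \<subseteq> A \<and> card B = x}"
  have dec: "ordered_partitions A (x # l) = (\<Union>B\<in>?S. (#) B ` ordered_partitions (A - B) l)"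
  proof (intro equalityI subsetI)
    fix Bs assume *: "Bs \<in> ordered_partitions A (x # l)"
    then have "map card Bs = x # l" by (simp add: ordered_partitions_def)
    then obtain B Cs where Bs: "Bs = B # Cs"
      by (auto simp: map_eq_Cons_conv)
    from * have BCs: "B \<notin> set Cs" "distinct Cs" "partition_on A (insert B (set Cs))"
      "card B = x" "map card Cs = l"
      by (simp_all add: Bs ordered_partitions_def)
    from partition_onD2[OF BCs(3)] BCs(1) have "\<forall>C\<in>set Cs. disjnt B C"
      by (auto simp: pairwise_insert)
    then have "disjnt B (\<Union>(set Cs))"
      by (simp add: disjnt_def Int_UN_distrib) blast
    with BCs(3) have "partition_on (A - B) (set Cs)" "B \<subseteq> A"
      by (simp_all add: partition_on_insert)
    with BCs show "Bs \<in> (\<Union>B\<in>?S. (#) B ` ordered_partitions (A - B) l)"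
      unfolding Bs ordered_partitions_def by blast
  next
    fix Bs assume "Bs \<in> (\<Union>B\<in>?S. (#) B ` ordered_partitions (A - B) l)"
    then obtain B Cs where *: "Bs = B # Cs" "B \<subseteq> A" "card B = x"
      and Cs: "distinct Cs" "partition_on (A - B) (set Cs)" "map card Cs = l"
      by (auto simp: ordered_partitions_def)
    have "B \<noteq> {}" using Cons.prems(2) *(3) by auto
    moreover have "disjnt B (\<Union>(set Cs))"
      using partition_onD1[OF Cs(2)] by (auto simp: disjnt_def)
    ultimately show "Bs \<in> ordered_partitions A (x # l)"
      using * Cs by (auto simp: ordered_partitions_def partition_on_insert disjnt_def)
  qed
  have IH: "card (ordered_partitions (A - B) l) * prod_list (map fact l) = fact (card A - x)"
    if "B \<in> ?S" for B
  proof -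
    have "card (A - B) = card A - x"
      using that Cons.prems(1) by (auto simp: card_Diff_subset finite_subset)
    then show ?thesis using Cons.IH[of "A - B"] Cons.prems by simp
  qed
  have "card (ordered_partitions A (x # l)) = (\<Sum>B\<in>?S. card (ordered_partitions (A - B) l))"
    unfolding dec using Cons.prems(1) by (intro card_Cons_UN finite_ordered_partitions) auto
  then have "card (ordered_partitions A (x # l)) * prod_list (map fact l)
      = (\<Sum>B\<in>?S. card (ordered_partitions (A - B) l) * prod_list (map fact l))"
    by (simp add: sum_distrib_right)
  also have "\<dots> = (card A choose x) * fact (card A - x)"
    using IH n_subsets[OF Cons.prems(1), of x] by simp
  finally show ?case
    using binomial_fact_lemma[of x "card A"] Cons.prems(3) by (simp add: algebra_simps)
qed

text \<open>
  Double counting: forgetting the order of the blocks sends the ordered partitions with block sizes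
  \<open>l\<close> onto the partitions of type \<open>mset l\<close>, and every fibre has the same size by
  \<open>card_orderings_with_image\<close>.
\<close>

lemma card_partitions_of_type:
  assumes "finite A" "\<forall>x\<in>set l. 0 < x" "sum_list l = card A" "finite I" "set l \<subseteq> I"
  shows "card {P. partition_on A P \<and> image_mset card (mset_set P) = mset l}
           * (\<Prod>i\<in>I. fact (count_list l i)) * prod_list (map fact l) = fact (card A)"
proof -
  let ?T = "{P. partition_on A P \<and> image_mset card (mset_set P) = mset l}"
  let ?X = "\<lambda>P. {Bs. distinct Bs \<and> set Bs = P \<and> map card Bs = l}"
  have finP: "finite P" if "P \<in> ?T" for P
    using that assms(1) finite_elements by blast
  have "finite ?T"
    using finitely_many_partition_on[OF assms(1)] by (rule rev_finite_subset) auto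
  have un: "ordered_partitions A l = (\<Union>P\<in>?T. ?X P)"
  proof (intro equalityI subsetI)
    fix Bs assume "Bs \<in> ordered_partitions A l"
    then have Bs: "distinct Bs" "partition_on A (set Bs)" "map card Bs = l"
      by (simp_all add: ordered_partitions_def)
    then have "image_mset card (mset_set (set Bs)) = mset l"
      by (simp add: mset_set_set flip: mset_map)
    with Bs show "Bs \<in> (\<Union>P\<in>?T. ?X P)" by simp
  qed (auto simp: ordered_partitions_def)
  have finX: "finite (?X P)" if "P \<in> ?T" for P
    using finite_ordered_partitions[OF assms(1), of l]
    by (rule rev_finite_subset) (use that in \<open>auto simp: ordered_partitions_def\<close>)
  have disj: "?X P \<inter> ?X Q = {}" if "P \<noteq> Q" for P Q
    using that by fast
  have "card (ordered_partitions A l) = (\<Sum>P\<in>?T. card (?X P))"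
    unfolding un
  proof (rule card_UN_disjoint[OF \<open>finite ?T\<close>])
    show "\<forall>P\<in>?T. finite (?X P)" by (intro ballI finX)
    show "\<forall>P\<in>?T. \<forall>Q\<in>?T. P \<noteq> Q \<longrightarrow> ?X P \<inter> ?X Q = {}" by (intro ballI impI disj)
  qed
  also have "\<dots> = (\<Sum>P\<in>?T. \<Prod>i\<in>I. fact (count_list l i))"
  proof (rule sum.cong[OF refl])
    fix P assume "P \<in> ?T"
    then show "card (?X P) = (\<Prod>i\<in>I. fact (count_list l i))"
      using card_orderings_with_image[OF finP _ assms(4,5)] by blast
  qed
  finally show ?thesis
    using card_ordered_partitions[OF assms(1-3)] by simp
qed

text \<open>
  The block sizes of a set partition, in weakly decreasing order as \<open>Part\<close> demands.
\<close>

definition partition_type :: "'a set set \<Rightarrow> nat list" where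
  "partition_type P = rev (sorted_list_of_multiset (image_mset card (mset_set P)))"

lemma mset_partition_type: "mset (partition_type P) = image_mset card (mset_set P)"
  by (simp add: partition_type_def)

lemma partition_type_eq_iff:
  assumes "l \<in> Part n k"
  shows "partition_type P = l \<longleftrightarrow> image_mset card (mset_set P) = mset l"
proof
  assume *: "image_mset card (mset_set P) = mset l"
  have "sorted (rev l)"
    using assms by (simp add: Part_def sorted_wrt_rev)
  then have "sorted_list_of_multiset (mset (rev l)) = rev l"
    by (metis sorted_list_of_multiset_mset sorted_sort_id)
  then show "partition_type P = l"
    by (simp add: partition_type_def *)
qed (use mset_partition_type in metis)

lemma partition_type_in_Part:
  assumes "finite A" "partition_on A P"
  shows "partition_type P \<in> Part (card A) (card P)"
proof -
  have fin: "finite P" "\<And>B. B \<in> P \<Longrightarrow> finite B"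
    using finite_elements[OF assms] partition_onD1[OF assms(2)] assms(1)
    by (auto intro: finite_subset)
  have "set (partition_type P) = card ` P"
    by (metis mset_partition_type set_mset_mset finite_set_mset_mset_set fin(1) set_image_mset)
  moreover have "0 < card B" if "B \<in> P" for B
    using that fin partition_onD3[OF assms(2)] by (auto simp: card_gt_0_iff)
  moreover have "length (partition_type P) = card P"
    by (metis mset_partition_type size_mset size_image_mset size_mset_set)
  moreover have "sum_list (partition_type P) = card A"
  proof -
    have "sum_list (partition_type P) = (\<Sum>B\<in>P. card B)"
      by (metis mset_partition_type sum_mset_sum_list sum_unfold_sum_mset)
    then show ?thesis
      using product_partition[OF assms(2) fin(2)] by simp
  qed
  moreover have "sorted_wrt (\<ge>) (partition_type P)"
    by (simp add: partition_type_def sorted_wrt_rev)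
  ultimately show ?thesis by (auto simp: Part_def)
qed

lemma Part_bounds:
  assumes "l \<in> Part n k"
  shows "k \<le> n" "set l \<subseteq> {1..n}"
proof -
  have "length l \<le> sum_list l" if "\<forall>x\<in>set l. 0 < x" for l :: "nat list"
    using that by (induction l) auto
  then show "k \<le> n" using assms by (auto simp: Part_def)
  show "set l \<subseteq> {1..n}" using assms by (auto simp: Part_def Suc_le_eq member_le_sum_list)
qed

lemma finite_Part: "finite (Part n k)"
proof (rule finite_subset)
  show "Part n k \<subseteq> {l. set l \<subseteq> {1..n} \<and> length l = k}"
    using Part_bounds(2) by (fastforce simp: Part_def)
qed (simp add: finite_lists_length_eq)

text \<open>
  The summand depends only on the sizes of the blocks, so the partitions may be grouped, first by
  the number of blocks and then by type.
\<close>

lemma sum_partitions_by_type: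
  fixes f :: "nat \<Rightarrow> real" and A :: "'a set"
  assumes "finite A" and "card A = n"
  shows "(\<Sum>P | partition_on A P \<and> 2 \<le> card P. \<Prod>B\<in>P. f (card B)) =
    (\<Sum>k = 2..n. \<Sum>l \<in> Part n k.
       multinomial n l / (\<Prod>i = 1..n. fact (count_list l i)) * (\<Prod>j<k. f (l ! j)))"
proof -
  let ?S = "{P. partition_on A P \<and> 2 \<le> card P}"
  let ?Sk = "\<lambda>k. {P. P \<in> ?S \<and> card P = k}"
  let ?h = "\<lambda>P. \<Prod>B\<in>P. f (card B)"
  have finS: "finite ?S"
    using finitely_many_partition_on[OF assms(1)] by (rule rev_finite_subset) auto
  have "card ` ?S \<subseteq> {2..n}"
    using partition_type_in_Part[OF assms(1)] Part_bounds(1) assms(2) by fastforce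
  then have "sum ?h ?S = (\<Sum>k=2..n. sum ?h (?Sk k))"
    using finS by (intro sum.group[symmetric]) auto
  also have "\<dots> = (\<Sum>k=2..n. \<Sum>l\<in>Part n k. sum ?h {P. P \<in> ?Sk k \<and> partition_type P = l})"
  proof (rule sum.cong[OF refl])
    fix k
    have "finite (?Sk k)" using finS by (rule rev_finite_subset) auto
    moreover have "partition_type ` ?Sk k \<subseteq> Part n k"
      using partition_type_in_Part[OF assms(1)] assms(2) by auto
    ultimately show "sum ?h (?Sk k) = (\<Sum>l\<in>Part n k. sum ?h {P. P \<in> ?Sk k \<and> partition_type P = l})"
      using finite_Part by (intro sum.group[symmetric])
  qed
  also have "\<dots> = (\<Sum>k=2..n. \<Sum>l\<in>Part n k.
       multinomial n l / (\<Prod>i = 1..n. fact (count_list l i)) * (\<Prod>j<k. f (l ! j)))"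
  proof (intro sum.cong refl)
    fix k l assume k: "k \<in> {2..n}" and l: "l \<in> Part n k"
    have len: "length l = k" using l by (simp add: Part_def)
    let ?T = "{P. partition_on A P \<and> image_mset card (mset_set P) = mset l}"
    have T: "{P. P \<in> ?Sk k \<and> partition_type P = l} = ?T"
    proof -
      have "card P = k" if "image_mset card (mset_set P) = mset l" for P :: "'a set set"
        using arg_cong[OF that, of size] by (simp add: len)
      then show ?thesis
        using k by (auto simp: partition_type_eq_iff[OF l])
    qed
    have "?h P = (\<Prod>j<k. f (l ! j))" if "P \<in> ?T" for P
    proof -
      have "?h P = prod_mset (image_mset f (image_mset card (mset_set P)))"
        by (simp add: prod_unfold_prod_mset multiset.map_comp comp_def)
      also have "\<dots> = prod_list (map f l)"
        using that by (simp add: prod_mset_prod_list flip: mset_map)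
      also have "\<dots> = (\<Prod>j<k. f (l ! j))"
        by (simp add: prod.list_conv_set_nth len atLeast0LessThan)
      finally show ?thesis .
    qed
    then have "sum ?h ?T = real (card ?T) * (\<Prod>j<k. f (l ! j))"
      by simp
    also have "real (card ?T) = multinomial n l / (\<Prod>i = 1..n. fact (count_list l i))"
    proof -
      have "card ?T * (\<Prod>i=1..n. fact (count_list l i)) * prod_list (map fact l) = fact n"
        using card_partitions_of_type[OF assms(1), of l "{1..n}"] l Part_bounds(2)[OF l] assms(2)
        by (simp add: Part_def)
      moreover have "prod_list (map fact l) = (\<Prod>j<length l. fact (l ! j) :: nat)"
        by (simp add: prod.list_conv_set_nth atLeast0LessThan)
      ultimately have "real (card ?T * (\<Prod>i=1..n. fact (count_list l i)) * (\<Prod>j<length l. fact (l ! j)))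
          = fact n"
        by (simp only: of_nat_fact)
      then have "real (card ?T) * (\<Prod>i=1..n. fact (count_list l i)) * (\<Prod>j<length l. fact (l ! j))
          = fact n"
        by (simp only: of_nat_mult of_nat_prod of_nat_fact)
      then show ?thesis
        by (simp add: multinomial_def divide_simps ac_simps)
    qed
    finally show "sum ?h {P. P \<in> ?Sk k \<and> partition_type P = l} =
        multinomial n l / (\<Prod>i = 1..n. fact (count_list l i)) * (\<Prod>j<k. f (l ! j))"
      unfolding T .
  qed
  finally show ?thesis .
qed

section \<open>Assembly trees of complete graphs\<close>

definition glued :: "'a ltree \<Rightarrow> bool" where
  "glued t \<longleftrightarrow> (\<forall>s \<in> subtrees t. internal s \<longrightarrow>
     2 \<le> size (children s) \<and> label s = (\<Union>c \<in> set_mset (children s). label c))"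

definition singletons :: "'a set \<Rightarrow> 'a set multiset" where
  "singletons A = image_mset (\<lambda>v. {v}) (mset_set A)"

text \<open>
  The assembly trees of the complete graph with vertex set \<open>A\<close>. Only the vertex set is a
  parameter, so that each child of a tree on \<open>A\<close> is an object of the same kind, on its own label.
\<close>

definition trees_on :: "'a set \<Rightarrow> 'a ltree set" where
  "trees_on A = {t. label t = A \<and> glued t \<and> leaf_labels t = singletons A}"

lemma glued_Node:
  "glued (Node U ts) \<longleftrightarrow>
     (ts \<noteq> {#} \<longrightarrow> 2 \<le> size ts \<and> U = (\<Union>c \<in> set_mset ts. label c)) \<and> (\<forall>c \<in># ts. glued c)"
  by (auto simp: glued_def internal_def)

lemma glued_subtree: "glued t \<Longrightarrow> s \<in> subtrees t \<Longrightarrow> glued s"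
proof (induction t)
  case (Node U ts)
  then show ?case by (auto simp: glued_Node)
qed

lemma leaf_labels_subtree: "s \<in> subtrees t \<Longrightarrow> leaf_labels s \<subseteq># leaf_labels t"
proof (induction t)
  case (Node U ts)
  show ?case
  proof (cases "s = Node U ts")
    case False
    then obtain c where c: "c \<in># ts" "s \<in> subtrees c" using Node.prems by auto
    then have "leaf_labels s \<subseteq># leaf_labels c" using Node.IH by auto
    also have "\<dots> \<subseteq># leaf_labels (Node U ts)"
      using c(1) by (auto dest!: multi_member_split)
    finally show ?thesis .
  qed simp
qed

lemma leaf_labels_nonempty: "leaf_labels t \<noteq> {#}"
proof (induction t)
  case (Node U ts)
  then show ?case by (auto dest!: multi_member_split elim!: multiset_nonemptyE)
qed

lemma label_eq_Union_leaf_labels: "glued t \<Longrightarrow> label t = \<Union>(set_mset (leaf_labels t))"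
proof (induction t)
  case (Node U ts)
  show ?case
  proof (cases "ts = {#}")
    case False
    have "label (Node U ts) = (\<Union>c\<in>set_mset ts. label c)"
      using False Node.prems by (simp add: glued_Node)
    also have "\<dots> = (\<Union>c\<in>set_mset ts. \<Union>(set_mset (leaf_labels c)))"
      using Node by (intro SUP_cong refl) (auto simp: glued_Node)
    also have "\<dots> = \<Union>(set_mset (leaf_labels (Node U ts)))"
      using False by auto
    finally show ?thesis .
  qed simp
qed

lemma submultiset_of_singletons:
  assumes "finite A" "M \<subseteq># singletons A"
  shows "M = singletons (\<Union>(set_mset M))"
proof -
  have sA: "singletons B = mset_set ((\<lambda>v. {v}) ` B)" for B :: "'a set"
    unfolding singletons_def by (rule image_mset_mset_set) simp
  have sub: "set_mset M \<subseteq> (\<lambda>v. {v}) ` A"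
    using set_mset_mono[OF assms(2)] assms(1) by (simp add: sA)
  have "M = mset_set (set_mset M)"
  proof (rule multiset_eqI)
    fix x
    have "count M x \<le> count (singletons A) x"
      using assms(2) by (rule mset_subset_eq_count)
    also have "\<dots> \<le> 1" by (simp add: sA count_mset_set')
    finally show "count M x = count (mset_set (set_mset M)) x"
      by (cases "count M x") (auto simp: count_mset_set' not_in_iff simp flip: count_greater_zero_iff)
  qed
  also have "set_mset M = (\<lambda>v. {v}) ` \<Union>(set_mset M)"
    using sub by fastforce
  finally show ?thesis by (simp add: sA)
qed

text \<open>
  The label of a glued tree is the union of its leaf labels. Hence, if these are distinct
  singletons, they are exactly the singletons of the elements of the label. The lemma is meant for
  the subtrees of an assembly tree on \<open>A\<close>, whose leaves form a submultiset of all the leaves. Labels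
  are nonempty because every tree has a leaf.
\<close>

lemma trees_on_label_if_leaves_subset:
  assumes "glued t" "finite A" "leaf_labels t \<subseteq># singletons A"
  shows "label t \<subseteq> A" "label t \<noteq> {}" "t \<in> trees_on (label t)"
proof -
  have L: "label t = \<Union>(set_mset (leaf_labels t))"
    by (rule label_eq_Union_leaf_labels[OF assms(1)])
  have sub: "set_mset (leaf_labels t) \<subseteq> (\<lambda>v. {v}) ` A"
    using set_mset_mono[OF assms(3)] assms(2) by (simp add: singletons_def)
  then show "label t \<subseteq> A" unfolding L by auto
  show "label t \<noteq> {}"
    using sub leaf_labels_nonempty[of t] unfolding L by (auto elim!: multiset_nonemptyE)
  show "t \<in> trees_on (label t)"
    using assms submultiset_of_singletons[OF assms(2,3)] by (simp add: trees_on_def L)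
qed

lemma connected_induced_complete_graph:
  assumes "S \<noteq> {}" "S \<subseteq> {..<n}"
  shows "Digraph_Component.connected (complete_graph n \<restriction> S)"
proof -
  let ?H = "complete_graph n \<restriction> S"
  interpret G: graph "complete_graph n" by (rule graph_complete_graph)
  have wf: "wf_digraph ?H"
    using assms(2) by (intro G.wellformed_induce_subgraph)
  have V: "verts ?H = S" by simp
  have E: "(u, v) \<in> arcs_ends ?H" if "u \<in> S" "v \<in> S" "u \<noteq> v" for u v
    using that assms(2)
    by (auto simp: arcs_ends_def arc_to_ends_def complete_graph_def)
  have "u \<rightarrow>\<^sup>*\<^bsub>?H\<^esub> v" if "u \<in> S" "v \<in> S" for u v
  proof (cases "u = v")
    case True
    then show ?thesis using that V wf_digraph.reachable_refl[OF wf] by simp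
  next
    case False
    then show ?thesis using that E wf_digraph.reachable_adjI[OF wf] by blast
  qed
  then have "u \<rightarrow>\<^sup>*\<^bsub>with_proj (mk_symmetric ?H)\<^esub> v" if "u \<in> S" "v \<in> S" for u v
    using that wf_digraph.reachable_mk_symmetricI[OF wf] by blast
  then show ?thesis
    using assms(1) V unfolding Digraph_Component.connected_def strongly_connected_def by auto
qed

text \<open>
  Every nonempty set of vertices of a complete graph induces a connected subgraph, so the gluing
  rule is satisfied by every assembly tree.
\<close>

lemma num_assembly_trees_complete_graph:
  "a\<^sup>C (complete_graph n) = card (trees_on {..<n})"
proof -
  have V: "verts (complete_graph n) = {..<n}" by (simp add: complete_graph_def)
  have "assembly_tree (complete_graph n) t \<and> connected_gluing (complete_graph n) t \<longleftrightarrow>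
      t \<in> trees_on {..<n}" for t
  proof
    assume t: "t \<in> trees_on {..<n}"
    have "label s \<subseteq> {..<n} \<and> label s \<noteq> {}" if "s \<in> subtrees t" for s
      using t trees_on_label_if_leaves_subset[of s "{..<n}"]
        glued_subtree[OF _ that] leaf_labels_subtree[OF that]
      by (simp add: trees_on_def)
    then have "\<forall>s\<in>subtrees t. label s \<subseteq> {..<n}" "connected_gluing (complete_graph n) t"
      by (simp_all add: connected_gluing_def connected_induced_complete_graph)
    with t show "assembly_tree (complete_graph n) t \<and> connected_gluing (complete_graph n) t"
      by (simp add: assembly_tree_def trees_on_def glued_def V singletons_def)
  qed (auto simp: assembly_tree_def trees_on_def glued_def V singletons_def)
  then show ?thesis by (simp add: num_assembly_trees_C_def)
qed

lemma singletons_Union: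
  assumes "finite P" "disjoint P" "\<And>B. B \<in> P \<Longrightarrow> finite B"
  shows "singletons (\<Union>P) = (\<Sum>B\<in>P. singletons B)"
  using assms
proof (induction P)
  case (insert B P)
  have "B \<inter> \<Union>P = {}"
    using insert.hyps(2) insert.prems(1) by (fastforce simp: disjoint_def)
  then have "singletons (B \<union> \<Union>P) = singletons B + singletons (\<Union>P)"
    using insert.hyps insert.prems by (simp add: singletons_def mset_set_Union)
  then show ?case
    using insert by (simp add: pairwise_insert)
qed (simp add: singletons_def)

text \<open>
  An internal root would have at least two children, each contributing a leaf, whereas there is only
  one leaf.
\<close>

lemma trees_on_singleton: "trees_on {v} = {Node {v} {#}}"
proof (intro equalityI subsetI)
  fix t assume t: "t \<in> trees_on {v}"
  obtain U ts where [simp]: "t = Node U ts" by (cases t)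
  have "ts = {#}"
  proof (rule ccontr)
    assume ts: "ts \<noteq> {#}"
    with t have "2 \<le> size ts" by (auto simp: trees_on_def glued_Node)
    also have "size ts \<le> size (\<Sum>\<^sub># (image_mset leaf_labels ts))"
    proof (induction ts)
      case (add c ts)
      have "0 < size (leaf_labels c)"
        using leaf_labels_nonempty[of c] by (simp flip: nonempty_has_size)
      then show ?case using add by simp
    qed simp
    also have "\<dots> = 1" using t ts by (simp add: trees_on_def singletons_def)
    finally show False by simp
  qed
  then show "t \<in> {Node {v} {#}}" using t by (simp add: trees_on_def)
qed (simp add: trees_on_def singletons_def glued_Node)

definition join_trees :: "'a set \<Rightarrow> ('a set \<Rightarrow> 'a ltree) \<Rightarrow> 'a set set \<Rightarrow> 'a ltree" where
  "join_trees A c P = Node A (image_mset c (mset_set P))"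

text \<open>
  An assembly tree is cut at its root: the labels of the children are the blocks of a partition of
  \<open>A\<close>, and each block carries an assembly tree of its own. Since distinct children have distinct
  labels, the multiset of children is the same as a function from blocks to trees. What has to be
  shown for surjectivity is that the labels of the children are disjoint; a vertex shared by two
  children would occur on two leaves.
\<close>

lemma bij_betw_join_trees:
  assumes A: "finite A" "2 \<le> card A"
  shows "bij_betw (\<lambda>(P, c). join_trees A c P)
    (SIGMA P : {P. partition_on A P \<and> 2 \<le> card P}. PiE P trees_on) (trees_on A)"
  (is "bij_betw ?j ?S _")
proof -
  have label_c: "label (c B) = B" if "c \<in> PiE P trees_on" "B \<in> P" for c :: "'a set \<Rightarrow> 'a ltree" and B P
    using PiE_mem[OF that] by (simp add: trees_on_def)
  have labels: "image_mset (label \<circ> c) (mset_set P) = mset_set P"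
    if "c \<in> PiE P trees_on" "finite P" for c :: "'a set \<Rightarrow> 'a ltree" and P
  proof -
    have "image_mset (label \<circ> c) (mset_set P) = image_mset (\<lambda>B. B) (mset_set P)"
      using that(2) label_c[OF that(1)] by (intro image_mset_cong) simp_all
    then show ?thesis by simp
  qed
  have finP: "finite P" if "partition_on A P" for P
    using finite_elements[OF A(1) that] .
  have "inj_on ?j ?S"
  proof (rule inj_onI, clarify)
    fix P c Q d
    assume P: "partition_on A P" "c \<in> PiE P trees_on" and Q: "partition_on A Q" "d \<in> PiE Q trees_on"
      and "join_trees A c P = join_trees A d Q"
    then have eq: "image_mset c (mset_set P) = image_mset d (mset_set Q)"
      by (simp add: join_trees_def)
    have "mset_set P = image_mset label (image_mset c (mset_set P))"
      using labels[OF P(2) finP[OF P(1)]] by (simp add: multiset.map_comp)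
    also have "\<dots> = mset_set Q"
      unfolding eq using labels[OF Q(2) finP[OF Q(1)]] by (simp add: multiset.map_comp)
    finally have PQ: "P = Q"
      using finP[OF P(1)] finP[OF Q(1)] by (simp add: mset_set_eq_iff)
    have img: "c ` P = d ` P"
      using arg_cong[OF eq, of set_mset] finP[OF P(1)] by (simp add: PQ)
    have "c = d"
    proof (rule PiE_ext[OF P(2) Q(2)[folded PQ]])
      fix B assume B: "B \<in> P"
      then obtain B' where B': "B' \<in> P" "c B = d B'" using img by auto
      then have "B = B'" using label_c[OF P(2) B] label_c[OF Q(2)[folded PQ] B'(1)] by simp
      then show "c B = d B" using B' by simp
    qed
    then show "P = Q \<and> c = d" using PQ by simp
  qed
  moreover have "?j z \<in> trees_on A" if "z \<in> ?S" for z
  proof -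
    obtain P c where z: "z = (P, c)" by (cases z)
    with that have P: "partition_on A P" "2 \<le> card P" and c: "c \<in> PiE P trees_on" by auto
    note fin = finP[OF P(1)]
    have "P \<noteq> {}" using P(2) by auto
    have cB: "glued (c B) \<and> leaf_labels (c B) = singletons B" if "B \<in> P" for B
      using PiE_mem[OF c that] by (simp add: trees_on_def)
    have "\<Sum>\<^sub># (image_mset leaf_labels (image_mset c (mset_set P))) = (\<Sum>B\<in>P. leaf_labels (c B))"
      by (simp add: multiset.map_comp comp_def sum_unfold_sum_mset)
    also have "\<dots> = (\<Sum>B\<in>P. singletons B)" using cB by simp
    also have "\<dots> = singletons (\<Union>P)"
      using partition_onD1[OF P(1)] partition_onD2[OF P(1)] A(1) fin
      by (intro singletons_Union[symmetric]) (auto intro: finite_subset)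
    also have "\<Union>P = A" using partition_onD1[OF P(1)] by simp
    finally have leaves: "\<Sum>\<^sub># (image_mset leaf_labels (image_mset c (mset_set P))) = singletons A" .
    have "(\<Union>B\<in>P. label (c B)) = \<Union>P" using label_c[OF c] by auto
    then show ?thesis
      using leaves fin cB P \<open>P \<noteq> {}\<close> partition_onD1[OF P(1)]
      by (simp add: z join_trees_def trees_on_def glued_Node mset_set_empty_iff)
  qed
  moreover have "t \<in> ?j ` ?S" if t: "t \<in> trees_on A" for t
  proof -
    obtain ts where t_eq: "t = Node A ts" using t by (cases t) (auto simp: trees_on_def)
    have "ts \<noteq> {#}"
    proof
      assume "ts = {#}"
      then have "singletons A = {#A#}" using t by (simp add: t_eq trees_on_def)
      then have "card A = 1" by (metis singletons_def size_image_mset size_mset_set size_single)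
      then show False using A(2) by simp
    qed
    with t have ts: "2 \<le> size ts" "A = (\<Union>c\<in>set_mset ts. label c)" "\<And>c. c \<in># ts \<Longrightarrow> glued c"
      and leaves: "\<Sum>\<^sub># (image_mset leaf_labels ts) = singletons A"
      by (simp_all add: t_eq trees_on_def glued_Node)
    have child: "label c \<noteq> {}" "c \<in> trees_on (label c)" if "c \<in># ts" for c
    proof -
      have "leaf_labels c \<subseteq># singletons A"
        unfolding leaves[symmetric] using that by (auto dest!: multi_member_split)
      then show "label c \<noteq> {}" "c \<in> trees_on (label c)"
        using trees_on_label_if_leaves_subset[OF ts(3)[OF that] A(1)] by auto
    qed
    \<comment> \<open>The trees \<open>c\<close> and \<open>d\<close> may be equal; as labels are nonempty, that case rules out repeated
      children.\<close>
    have disj: "label c \<inter> label d = {}" if cd: "ts = add_mset c (add_mset d us)" for c d us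
    proof (rule ccontr)
      assume "label c \<inter> label d \<noteq> {}"
      then obtain v where v: "v \<in> label c" "v \<in> label d" by auto
      have ch: "c \<in># ts" "d \<in># ts" by (simp_all add: cd)
      have lab: "finite (label c)" "finite (label d)" "label c \<subseteq> A"
        using ch ts(2) A(1) by (auto intro: finite_subset)
      have "{#{v}#} \<subseteq># leaf_labels c" "{#{v}#} \<subseteq># leaf_labels d"
        using child(2)[OF ch(1)] child(2)[OF ch(2)] v lab
        by (auto simp: trees_on_def singletons_def)
      then have "{#{v}#} + {#{v}#} \<subseteq># leaf_labels c + leaf_labels d"
        by (rule subset_mset.add_mono)
      also have "\<dots> \<subseteq># singletons A"
        unfolding leaves[symmetric] by (simp add: cd)
      finally have "count {#{v}, {v}#} {v} \<le> count (singletons A) {v}"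
        by (intro mset_subset_eq_count) simp
      moreover have "singletons A = mset_set ((\<lambda>v. {v}) ` A)"
        unfolding singletons_def by (rule image_mset_mset_set) simp
      ultimately show False by (simp add: count_mset_set' split: if_splits)
    qed
    have two: "label c \<inter> label d = {}" if cd: "c \<in># ts" "d \<in># ts" "c \<noteq> d" for c d
    proof -
      have "d \<in># ts - {#c#}" using cd by (simp add: in_diff_count)
      then obtain us where "ts - {#c#} = add_mset d us" by (blast dest: multi_member_split)
      then have "ts = add_mset c (add_mset d us)" using cd(1) by (metis insert_DiffM)
      then show ?thesis by (rule disj)
    qed
    define P where "P = label ` set_mset ts"
    have inj: "inj_on label (set_mset ts)"
      using two child(1) by (intro inj_onI) (metis Int_absorb)
    have "ts = mset_set (set_mset ts)"
    proof (rule multiset_eqI)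
      fix c
      have "count ts c \<le> 1"
      proof (rule ccontr)
        assume "\<not> count ts c \<le> 1"
        then have "c \<in># ts" "c \<in># ts - {#c#}" by (auto simp flip: count_greater_zero_iff)
        then obtain us where "ts = add_mset c (add_mset c us)" by (metis insert_DiffM)
        from disj[OF this] child(1)[OF \<open>c \<in># ts\<close>] show False by simp
      qed
      then show "count ts c = count (mset_set (set_mset ts)) c"
        by (cases "count ts c") (auto simp: count_mset_set' not_in_iff simp flip: count_greater_zero_iff)
    qed
    then have mP: "image_mset label ts = mset_set P"
      unfolding P_def by (metis image_mset_mset_set inj)
    define c where "c = restrict (inv_into (set_mset ts) label) P"
    have c_label: "c (label s) = s" if "s \<in># ts" for s
      using that inj by (simp add: c_def P_def)
    have "image_mset c (mset_set P) = image_mset (\<lambda>s. s) ts"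
      unfolding mP[symmetric] multiset.map_comp by (rule image_mset_cong) (simp add: c_label)
    then have "t = ?j (P, c)" by (simp add: t_eq join_trees_def)
    moreover have "partition_on A P"
      using two child(1) ts(2) unfolding P_def
      by (intro partition_onI) (auto simp: disjnt_def eq_commute[of "{}"])
    moreover have "2 \<le> card P"
      using ts(1) mP by (metis size_image_mset size_mset_set)
    moreover have "c \<in> PiE P trees_on"
      using child(2) c_label by (auto simp: P_def c_def)
    ultimately show ?thesis by blast
  qed
  ultimately show ?thesis unfolding bij_betw_def by blast
qed

lemma block_of_nontrivial_partition:
  assumes "finite A" "partition_on A P" "2 \<le> card P" "B \<in> P"
  shows "finite B" "card B < card A"
proof -
  have "P \<noteq> {B}" using assms(3) by auto
  then obtain C where C: "C \<in> P" "C \<noteq> B" using assms(4) by auto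
  have "C \<noteq> {}" "C \<inter> B = {}" "B \<subseteq> A" "C \<subseteq> A"
    using C assms(2,4) by (auto simp: partition_on_def disjoint_def)
  then have "B \<subset> A" by blast
  then show "finite B" "card B < card A"
    using assms(1) by (auto intro: psubset_card_mono finite_subset)
qed

lemma trees_on_empty: "trees_on {} = {}"
  by (simp add: trees_on_def singletons_def leaf_labels_nonempty)

lemma finite_trees_on: "finite A \<Longrightarrow> finite (trees_on A)"
proof (induction "card A" arbitrary: A rule: less_induct)
  case less
  consider "A = {}" | v where "A = {v}" | "2 \<le> card A"
    using less.prems by (metis One_nat_def Suc_leI card_0_eq card_1_singletonE le_neq_implies_less
        not_gr0 numeral_2_eq_2)
  then show ?case
  proof cases
    case 1
    then show ?thesis
      by (simp add: trees_on_empty)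
  next
    case 2
    then show ?thesis by (simp add: trees_on_singleton)
  next
    case 3
    have "finite (SIGMA P : {P. partition_on A P \<and> 2 \<le> card P}. PiE P trees_on)"
    proof (intro finite_SigmaI)
      show "finite {P. partition_on A P \<and> 2 \<le> card P}"
        using finitely_many_partition_on[OF less.prems] by (rule rev_finite_subset) auto
      fix P assume P: "P \<in> {P. partition_on A P \<and> 2 \<le> card P}"
      have "finite (trees_on B)" if "B \<in> P" for B
        using less.hyps block_of_nontrivial_partition[OF less.prems _ _ that] P by blast
      then show "finite (PiE P trees_on)"
        using finite_elements[OF less.prems] P by (intro finite_PiE) auto
    qed
    then show ?thesis
      using bij_betw_finite[OF bij_betw_join_trees[OF less.prems 3]] by simp
  qed
qed

lemma card_trees_on_rec:
  assumes "finite A" "2 \<le> card A"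
  shows "card (trees_on A) = (\<Sum>P | partition_on A P \<and> 2 \<le> card P. \<Prod>B\<in>P. card (trees_on B))"
proof -
  let ?S = "{P. partition_on A P \<and> 2 \<le> card P}"
  have "finite ?S"
    using finitely_many_partition_on[OF assms(1)] by (rule rev_finite_subset) auto
  have "card (trees_on A) = card (SIGMA P : ?S. PiE P trees_on)"
    using bij_betw_same_card[OF bij_betw_join_trees[OF assms]] by simp
  also have "\<dots> = (\<Sum>P\<in>?S. card (PiE P trees_on))"
  proof (rule card_SigmaI[OF \<open>finite ?S\<close>], intro ballI finite_PiE finite_trees_on)
    show "finite P" if "P \<in> ?S" for P
      using that finite_elements[OF assms(1)] by simp
    show "finite B" if "P \<in> ?S" "B \<in> P" for P B
      using that block_of_nontrivial_partition(1)[OF assms(1), of P B] by simp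
  qed
  also have "\<dots> = (\<Sum>P\<in>?S. \<Prod>B\<in>P. card (trees_on B))"
    using finite_elements[OF assms(1)] by (intro sum.cong refl card_PiE) auto
  finally show ?thesis .
qed

section \<open>The recursion\<close>

text \<open>
  Here \<open>f\<close> stands for the number of trees as a function of the size. It has to be
  correct on sets smaller than \<open>A\<close>, which is what an induction on the size provides.
\<close>

lemma real_card_trees_on:
  fixes A :: "'a set" and f :: "nat \<Rightarrow> nat"
  assumes A: "finite A" "card A = n" "2 \<le> n"
    and f: "\<And>B :: 'a set. finite B \<Longrightarrow> card B < n \<Longrightarrow> card (trees_on B) = f (card B)"
  shows "real (card (trees_on A)) =
    (\<Sum>k = 2..n. \<Sum>l \<in> Part n k.
       multinomial n l / (\<Prod>i = 1..n. fact (count_list l i)) * (\<Prod>j<k. real (f (l ! j))))"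
proof -
  have "card (trees_on A) = (\<Sum>P | partition_on A P \<and> 2 \<le> card P. \<Prod>B\<in>P. card (trees_on B))"
    using A by (intro card_trees_on_rec) simp_all
  also have "\<dots> = (\<Sum>P | partition_on A P \<and> 2 \<le> card P. \<Prod>B\<in>P. f (card B))"
  proof (rule sum.cong[OF refl], rule prod.cong[OF refl])
    fix P B assume "P \<in> {P. partition_on A P \<and> 2 \<le> card P}" "B \<in> P"
    then show "card (trees_on B) = f (card B)"
      using block_of_nontrivial_partition[OF A(1), of P B] A(2) f by simp
  qed
  finally have "real (card (trees_on A)) =
      (\<Sum>P | partition_on A P \<and> 2 \<le> card P. \<Prod>B\<in>P. real (f (card B)))"
    by simp
  then show ?thesis
    using sum_partitions_by_type[OF A(1,2), of "\<lambda>m. real (f m)"] by simp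
qed

text \<open>
  The recursion \<open>real_card_trees_on\<close> refers to \<open>A\<close> only through its size; it is applied both to
  \<open>A\<close> and to \<open>{..<card A}\<close>, whose blocks are smaller and covered by the induction hypothesis.
\<close>

lemma card_trees_on_eq:
  fixes A :: "nat set"
  assumes "finite A"
  shows "card (trees_on A) = card (trees_on {..<card A})"
  using assms
proof (induction "card A" arbitrary: A rule: less_induct)
  case less
  consider "A = {}" | v where "A = {v}" | "2 \<le> card A"
    using less.prems by (metis One_nat_def Suc_leI card_0_eq card_1_singletonE le_neq_implies_less
        not_gr0 numeral_2_eq_2)
  then show ?case
  proof cases
    case 2
    have "{..<1::nat} = {0}" by auto
    then show ?thesis by (simp add: 2 trees_on_singleton)
  next
    case 3
    have IH: "card (trees_on B) = card (trees_on {..<card B})"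
      if "finite B" "card B < card A" for B :: "nat set"
      using less.hyps[OF that(2,1)] .
    have "real (card (trees_on A)) = real (card (trees_on {..<card A}))"
      using real_card_trees_on[OF less.prems refl 3 IH]
        real_card_trees_on[OF finite_lessThan card_lessThan 3 IH] by simp
    then show ?thesis by simp
  qed (simp add: trees_on_empty)
qed

theorem theorem3p8:
  fixes n :: nat
  assumes "n \<ge> 2"
  shows "real (a\<^sup>C (complete_graph n)) =
    (\<Sum>k = 2..n. \<Sum>l \<in> Part n k.
       multinomial n l / (\<Prod>i = 1..n. fact (count_list l i))
       * (\<Prod>j<k. real (a\<^sup>C (complete_graph (l ! j)))))"
  unfolding num_assembly_trees_complete_graph
proof (rule real_card_trees_on[OF finite_lessThan card_lessThan assms])
  show "card (trees_on B) = card (trees_on {..<card B})" if "finite B" for B :: "nat set"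
    using that by (rule card_trees_on_eq)
qed

end
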